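(* Let $\mathbb{F}$ be a finite field and $n\ge1$. The completely isolated subsemigroups of $M(n,\mathbb{F})$ are exactly $M(n,\mathbb{F})$, $\mathrm{GL}(n,\mathbb{F})$ and $I_{n-1}=M(n,\mathbb{F})\setminus\mathrm{GL}(n,\mathbb{F})$.
   Context: $M(n,\mathbb{F})$ is the semigroup of $n\times n$ matrices over $\mathbb{F}$ under multiplication; $\mathrm{GL}(n,\mathbb{F})$ is its group of units; $I_{n-1}$ is the set of all matrices of rank at most $n-1$. A (nonempty) subsemigroup $T$ of a semigroup $S$ is completely isolated if for all $x,y\in S$, $xy\in T$ implies $x\in T$ or $y\in T$. *)

theory Defs
  imports "HOL-Analysis.Analysis"
begin

text \<open>n x n matrices over a field are 'a^'n^'n (n = CARD('n) \<ge> 1), multiplication is **.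
  A nonempty subsemigroup T of M(n,F) is completely isolated if
  x ** y \<in> T implies x \<in> T or y \<in> T, for all matrices x, y.\<close>

definition completely_isolated :: "('a::semiring_1^'n^'n) set \<Rightarrow> bool" where
  "completely_isolated T \<longleftrightarrow>
     T \<noteq> {} \<and>
     (\<forall>x\<in>T. \<forall>y\<in>T. x ** y \<in> T) \<and>
     (\<forall>x y. x ** y \<in> T \<longrightarrow> x \<in> T \<or> y \<in> T)"

end

theory Submission
  imports Defs
begin

text \<open>A completely isolated T is a subsemigroup whose complement is empty or again a
  subsemigroup. So, unless T is everything, M(n,F) splits into two subsemigroups X and Y with
  the identity in X. Every invertible g lies in X: left multiplication by g permutes the finite
  subsemigroup containing g, so that subsemigroup contains the identity. Hence Y is closed under
  right multiplication by invertible matrices and both parts are closed under q \<mapsto> q g q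
  with g invertible. For singular q \<noteq> 0 some invertible g sends a nonzero vector of the
  image of q into its kernel, and then q g q has a smaller image; iterating reaches 0. As 0 lies in
  only one part, that part holds all singular matrices and the other one is GL(n,F).\<close>

definition mult_closed :: "('a::semiring_1^'n^'n) set \<Rightarrow> bool" where
  "mult_closed S \<longleftrightarrow> (\<forall>x\<in>S. \<forall>y\<in>S. x ** y \<in> S)"

lemma completely_isolated_iff_mult_closed:
  "completely_isolated T \<longleftrightarrow> T \<noteq> {} \<and> mult_closed T \<and> mult_closed (- T)"
  unfolding completely_isolated_def mult_closed_def by blast

lemma invertible_mat_1: "invertible (mat 1 :: 'a::field^'n^'n)"
  by (simp add: invertible_det_nz)

lemma not_invertible_zero: "\<not> invertible (0 :: 'a::field^'n^'n)"
  by (metis det_0 invertible_det_nz mat_0)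

lemma invertible_mult_iff:
  fixes A B :: "'a::field^'n^'n"
  shows "invertible (A ** B) \<longleftrightarrow> invertible A \<and> invertible B"
  by (simp add: invertible_det_nz det_mul)

lemma mult_closed_invertible: "mult_closed {A :: 'a::field^'n^'n. invertible A}"
  by (simp add: mult_closed_def invertible_mult)

lemma mult_closed_singular: "mult_closed {A :: 'a::field^'n^'n. \<not> invertible A}"
  by (simp add: mult_closed_def invertible_mult_iff)

lemma invertible_map_vector_shared_nonzero_coordinate:
  fixes w k :: "'a::field^'n"
  assumes "w$i \<noteq> 0" "k$i \<noteq> 0"
  shows "\<exists>g. invertible g \<and> g *v w = k"
proof -
  define g where "g = ((\<chi> r c. (if r = c then 1 else 0) + (if c = i then (k$r - w$r) / w$i else 0))
    :: 'a^'n^'n)"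
  have g_apply: "(g *v x) $ r = x$r + (k$r - w$r) / w$i * x$i" for x r
  proof -
    have "(g *v x) $ r = (\<Sum>c\<in>UNIV. (if r = c then x$c else 0)
        + (if c = i then (k$r - w$r) / w$i * x$c else 0))"
      unfolding g_def matrix_vector_mult_def vec_lambda_beta
      by (intro sum.cong refl) (auto simp: algebra_simps)
    also have "\<dots> = x$r + (k$r - w$r) / w$i * x$i"
      by (simp only: sum.distrib sum.delta sum.delta' finite UNIV_I if_True)
    finally show ?thesis .
  qed
  have "g *v w = k"
    using assms by (simp add: vec_eq_iff g_apply)
  moreover have "invertible g"
    unfolding invertible_left_inverse matrix_left_invertible_ker
  proof (intro allI impI)
    fix x assume gx: "g *v x = 0"
    have "(g *v x) $ i = k$i / w$i * x$i"
      using assms by (simp add: g_apply field_simps)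
    then have "x$i = 0"
      using gx assms by simp
    then show "x = 0"
      using gx by (simp add: vec_eq_iff g_apply)
  qed
  ultimately show ?thesis by blast
qed

lemma invertible_map_nonzero_vector:
  fixes w k :: "'a::field^'n"
  assumes "w \<noteq> 0" "k \<noteq> 0"
  shows "\<exists>g. invertible g \<and> g *v w = k"
proof -
  obtain i where i: "w$i \<noteq> 0"
    using assms(1) by (metis vec_eq_iff zero_index)
  obtain j where j: "k$j \<noteq> 0"
    using assms(2) by (metis vec_eq_iff zero_index)
  define u :: "'a^'n" where "u = (\<chi> r. if r = i \<or> r = j then 1 else 0)"
  obtain g1 where g1: "invertible g1" "g1 *v w = u"
    using invertible_map_vector_shared_nonzero_coordinate[of w i u] i by (auto simp: u_def)
  obtain g2 where g2: "invertible g2" "g2 *v u = k"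
    using invertible_map_vector_shared_nonzero_coordinate[of u j k] j by (auto simp: u_def)
  have "invertible (g2 ** g1)" "(g2 ** g1) *v w = k"
    using g1 g2 by (simp_all add: invertible_mult flip: matrix_vector_mul_assoc)
  then show ?thesis by blast
qed

lemma card_range_matrix_mult_less:
  fixes A :: "'a::{comm_ring_1,finite}^'m^'k" and B :: "'a^'n^'m"
  assumes "B *v x \<noteq> 0" "A *v (B *v x) = 0"
  shows "card (range ((*v) (A ** B))) < card (range ((*v) B))"
proof -
  have range_AB: "range ((*v) (A ** B)) = (*v) A ` range ((*v) B)"
    by (auto simp flip: matrix_vector_mul_assoc)
  have "0 \<in> range ((*v) B)"
    by (rule range_eqI[of _ _ 0]) simp
  then have "\<not> inj_on ((*v) A) (range ((*v) B))"
    using assms by (auto dest: inj_onD[of _ _ "B *v x" 0])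
  then have "card ((*v) A ` range ((*v) B)) \<noteq> card (range ((*v) B))"
    using eq_card_imp_inj_on[of "range ((*v) B)" "(*v) A"] by auto
  moreover have "card ((*v) A ` range ((*v) B)) \<le> card (range ((*v) B))"
    by (rule card_image_le) simp
  ultimately show ?thesis
    unfolding range_AB by linarith
qed

lemma card_range_invertible_matrix_mult:
  fixes g :: "'a::field^'m^'m" and B :: "'a^'n^'m"
  assumes "invertible g"
  shows "card (range ((*v) (g ** B))) = card (range ((*v) B))"
proof -
  have "range ((*v) (g ** B)) = (*v) g ` range ((*v) B)"
    by (auto simp flip: matrix_vector_mul_assoc)
  then show ?thesis
    using inj_matrix_vector_mult[OF assms] by (simp add: card_image inj_on_subset)
qed

lemma singular_matrix_sandwich_shrinks_range:
  fixes p :: "'a::{field,finite}^'n^'n"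
  assumes "p \<noteq> 0" "\<not> invertible p"
  obtains g where "invertible g" "card (range ((*v) (p ** g ** p))) < card (range ((*v) p))"
proof -
  obtain x where x: "p *v x \<noteq> 0"
    using assms(1) by (metis matrix_eq matrix_vector_mult_0)
  obtain k where k: "k \<noteq> 0" "p *v k = 0"
    using assms(2) unfolding invertible_left_inverse matrix_left_invertible_ker by blast
  obtain g where g: "invertible g" "g *v (p *v x) = k"
    using invertible_map_nonzero_vector[OF x k(1)] by blast
  have "card (range ((*v) (p ** (g ** p)))) < card (range ((*v) (g ** p)))"
    by (rule card_range_matrix_mult_less[of "g ** p" x])
      (use g k in \<open>simp_all flip: matrix_vector_mul_assoc\<close>)
  with g(1) show ?thesis
    by (intro that) (simp_all add: card_range_invertible_matrix_mult matrix_mul_assoc)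
qed

lemma zero_mem_if_singular_mem:
  fixes Z :: "('a::{field,finite}^'n^'n) set"
  assumes sandwich_closed: "\<And>q g. q \<in> Z \<Longrightarrow> invertible g \<Longrightarrow> q ** g ** q \<in> Z"
  shows "p \<in> Z \<Longrightarrow> \<not> invertible p \<Longrightarrow> 0 \<in> Z"
proof (induction "card (range ((*v) p))" arbitrary: p rule: less_induct)
  case less
  show ?case
  proof (cases "p = 0")
    case True
    then show ?thesis using less.prems by simp
  next
    case False
    then obtain g where g: "invertible g" "card (range ((*v) (p ** g ** p))) < card (range ((*v) p))"
      using singular_matrix_sandwich_shrinks_range less.prems(2) by blast
    have "\<not> invertible (p ** g ** p)"
      using less.prems(2) by (simp add: invertible_mult_iff)
    then show ?thesis
      using less.hyps[OF g(2)] sandwich_closed[OF less.prems(1) g(1)] by blast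
  qed
qed

lemma mat_1_mem_if_invertible_mem:
  fixes Y :: "('a::{field,finite}^'n^'n) set"
  assumes "mult_closed Y" "g \<in> Y" "invertible g"
  shows "mat 1 \<in> Y"
proof -
  obtain g' where "g' ** g = mat 1"
    using assms(3) invertible_left_inverse by blast
  then have cancel: "x = y" if "g ** x = g ** y" for x y
    by (metis that matrix_mul_assoc matrix_mul_lid)
  have "inj_on ((**) g) Y"
    using cancel unfolding inj_on_def by blast
  then have "(**) g ` Y = Y"
    using assms(1,2) by (intro endo_inj_surj) (auto simp: mult_closed_def)
  then obtain y where "y \<in> Y" "g ** y = g ** mat 1"
    using assms(2) by (metis imageE matrix_mul_rid)
  with cancel show ?thesis by blast
qed

lemma mult_closed_with_complement_eq_invertible:
  fixes X :: "('a::{field,finite}^'n^'n) set"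
  assumes closed: "mult_closed X" "mult_closed (- X)" and one: "mat 1 \<in> X" and proper: "X \<noteq> UNIV"
  shows "X = {A. invertible A}"
proof -
  have invertible_mem: "g \<in> X" if "invertible g" for g
    using mat_1_mem_if_invertible_mem[OF closed(2) _ that] one by blast
  have complement_mult_invertible: "y ** g \<notin> X" if "y \<notin> X" "invertible g" for y g
  proof
    assume "y ** g \<in> X"
    obtain g' where g': "g ** g' = mat 1" "invertible g'"
      using \<open>invertible g\<close> unfolding invertible_def by blast
    have "y ** g ** g' \<in> X"
      using closed(1) invertible_mem[OF g'(2)] \<open>y ** g \<in> X\<close> by (simp add: mult_closed_def)
    with g'(1) \<open>y \<notin> X\<close> show False
      by (metis matrix_mul_assoc matrix_mul_rid)
  qed
  have "0 \<notin> X"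
  proof -
    obtain y where "y \<notin> X"
      using proper by blast
    moreover have "q ** g ** q \<notin> X" if "q \<notin> X" "invertible g" for q g
      using closed(2) complement_mult_invertible[OF that] that(1) by (simp add: mult_closed_def)
    ultimately show ?thesis
      using zero_mem_if_singular_mem[of "- X"] invertible_mem by blast
  qed
  moreover have "q ** g ** q \<in> X" if "q \<in> X" "invertible g" for q g
    using closed(1) invertible_mem that by (simp add: mult_closed_def)
  ultimately have "invertible x" if "x \<in> X" for x
    using zero_mem_if_singular_mem[of X] that by blast
  then show ?thesis
    using invertible_mem by blast
qed

theorem proposition25:
  fixes T :: "(('a::{field,finite})^'n^'n) set"
  shows "completely_isolated T \<longleftrightarrow>
           (T = UNIV \<or> T = {A. invertible A} \<or> T = {A. \<not> invertible A})"
proof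
  assume "completely_isolated T"
  then have nonempty: "T \<noteq> {}" and closed: "mult_closed T" "mult_closed (- T)"
    by (simp_all add: completely_isolated_iff_mult_closed)
  consider "T = UNIV" | "T \<noteq> UNIV" "mat 1 \<in> T" | "T \<noteq> UNIV" "mat 1 \<in> - T"
    by blast
  then show "T = UNIV \<or> T = {A. invertible A} \<or> T = {A. \<not> invertible A}"
  proof cases
    case 2
    then show ?thesis
      using mult_closed_with_complement_eq_invertible[OF closed] by blast
  next
    case 3
    then have "- T = {A. invertible A}"
      using mult_closed_with_complement_eq_invertible[of "- T"] closed nonempty by auto
    then show ?thesis by blast
  qed simp
next
  assume "T = UNIV \<or> T = {A. invertible A} \<or> T = {A. \<not> invertible A}"
  moreover have "- {A. invertible A} = {A :: 'a^'n^'n. \<not> invertible A}" by blast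
  ultimately show "completely_isolated T"
    using invertible_mat_1 not_invertible_zero mult_closed_invertible mult_closed_singular
    by (auto simp: completely_isolated_iff_mult_closed mult_closed_def)
qed

end
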